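(* Let $\ell$ be fixed. Let $A\in\mathbb R^{(m+pm)\times(m+pm)}$ be a symmetric positive definite $CB^3(\ell,\ell;1,0)$ or $CB^3(\ell,\ell;0,1)$ matrix and let $A\mathbf x=\mathbf b$ with $\mathbf x,\mathbf b\in\mathbb R^{m+pm}$. Then the solution $\mathbf x$ can be computed in optimal complexity, namely in $\mathcal O(N)$ arithmetic operations, where $N=m+pm$.
   Context: Operations are real arithmetic operations including square roots; the constant in $\mathcal O(N)$ is independent of $m$ and $p$. Cyclic banded matrix: $A\in\mathbb R^{m\times m}$ is cyclic banded with sub-bandwidths $(\ell,u)$ if $a_{ij}=0$ whenever $i-j>\ell$ or $j-i>u$, except possibly when $m-i+j\le u$ or $m+i-j\le\ell$. $CB^3$-arrowhead matrix: $A\in\mathbb R^{(m+pm)\times(m+pm)}$, partitioned into $(p+1)\times(p+1)$ blocks of size $m\times m$, is a $CB^3(\ell,u;\lambda,\mu)$ matrix if (1) it is block-banded with block-bandwidths $(\ell,u)$ (block $(I,J)$ vanishes unless $-\ell\le J-I\le u$); (2) the top-left block is cyclic banded with sub-bandwidths $(\lambda+\mu,\lambda+\mu)$; (3) the remaining blocks in the first block row are cyclic banded with sub-bandwidths $(\lambda,\mu)$; (4) the remaining blocks in the first block column are cyclic banded with sub-bandwidths $(\mu,\lambda)$; (5) all other blocks are diagonal. *)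

theory Defs
  imports Complex_Main "Jordan_Normal_Form.Matrix"
begin

text \<open>All row, column and block indices are 0-based; the bandwidth conditions depend on
  index differences only and are therefore the same as for 1-based indices. Index differences
  are taken in \<^typ>\<open>int\<close> to avoid truncated subtraction.\<close>

definition cyclic_banded :: "nat \<Rightarrow> nat \<Rightarrow> nat \<Rightarrow> real mat \<Rightarrow> bool" where
  "cyclic_banded m l u A \<longleftrightarrow>
     A \<in> carrier_mat m m \<and>
     (\<forall>i<m. \<forall>j<m.
        (int i - int j > int l \<or> int j - int i > int u) \<and>
        \<not> (int m - int i + int j \<le> int u \<or> int m + int i - int j \<le> int l)
        \<longrightarrow> A $$ (i, j) = 0)"

definition mat_block :: "nat \<Rightarrow> real mat \<Rightarrow> nat \<Rightarrow> nat \<Rightarrow> real mat" where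
  "mat_block m A I J = mat m m (\<lambda>(i, j). A $$ (I * m + i, J * m + j))"

text \<open>There are \<^term>\<open>p + 1\<close> block rows and block columns, numbered from 0 to \<^term>\<open>p\<close>.\<close>

definition CB3 :: "nat \<Rightarrow> nat \<Rightarrow> nat \<Rightarrow> nat \<Rightarrow> nat \<Rightarrow> nat \<Rightarrow> real mat \<Rightarrow> bool" where
  "CB3 m p l u lam mu A \<longleftrightarrow>
     A \<in> carrier_mat (m + p * m) (m + p * m) \<and>
     (\<forall>I\<le>p. \<forall>J\<le>p. \<not> (- int l \<le> int J - int I \<and> int J - int I \<le> int u)
        \<longrightarrow> mat_block m A I J = 0\<^sub>m m m) \<and>
     cyclic_banded m (lam + mu) (lam + mu) (mat_block m A 0 0) \<and>
     (\<forall>J\<in>{1..p}. cyclic_banded m lam mu (mat_block m A 0 J)) \<and>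
     (\<forall>I\<in>{1..p}. cyclic_banded m mu lam (mat_block m A I 0)) \<and>
     (\<forall>I\<in>{1..p}. \<forall>J\<in>{1..p}. diagonal_mat (mat_block m A I J))"

definition sym_pos_def :: "nat \<Rightarrow> real mat \<Rightarrow> bool" where
  "sym_pos_def n A \<longleftrightarrow>
     A \<in> carrier_mat n n \<and> transpose_mat A = A \<and>
     (\<forall>v\<in>carrier_vec n. v \<noteq> 0\<^sub>v n \<longrightarrow> v \<bullet> (A *\<^sub>v v) > 0)"

text \<open>An operand is an entry of the coefficient matrix, an entry of the right-hand side, an
  integer constant, or the result of an earlier operation of the program (numbered from 0).
  Reading an operand is free; every arithmetic operation has cost one. A program consists of
  its list of operations and the list of operands it outputs. It has no access to the real
  numbers other than through these operations, and in particular it cannot branch on them.\<close>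

datatype operand =
  MatEntry nat nat
| RhsEntry nat
| IntConst int
| Result nat

datatype arith_op =
  Add operand operand
| Sub operand operand
| Mul operand operand
| Div operand operand
| Sqrt operand

datatype program = Program (operations: "arith_op list") (outputs: "operand list")

definition num_ops :: "program \<Rightarrow> nat" where
  "num_ops P = length (operations P)"

fun operand_val :: "real mat \<Rightarrow> real vec \<Rightarrow> real list \<Rightarrow> operand \<Rightarrow> real option" where
  "operand_val A b rs (MatEntry i j) =
     (if i < dim_row A \<and> j < dim_col A then Some (A $$ (i, j)) else None)"
| "operand_val A b rs (RhsEntry i) = (if i < dim_vec b then Some (b $ i) else None)"
| "operand_val A b rs (IntConst c) = Some (real_of_int c)"
| "operand_val A b rs (Result k) = (if k < length rs then Some (rs ! k) else None)"

definition binop ::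
    "(real \<Rightarrow> real \<Rightarrow> real) \<Rightarrow> real option \<Rightarrow> real option \<Rightarrow> real option" where
  "binop f v w = Option.bind v (\<lambda>x. map_option (f x) w)"

text \<open>Division by zero and the square root of a negative number, which are total functions in
  HOL, make the execution fail.\<close>

fun op_val :: "real mat \<Rightarrow> real vec \<Rightarrow> real list \<Rightarrow> arith_op \<Rightarrow> real option" where
  "op_val A b rs (Add s t) = binop (+) (operand_val A b rs s) (operand_val A b rs t)"
| "op_val A b rs (Sub s t) = binop (-) (operand_val A b rs s) (operand_val A b rs t)"
| "op_val A b rs (Mul s t) = binop (*) (operand_val A b rs s) (operand_val A b rs t)"
| "op_val A b rs (Div s t) =
     (if operand_val A b rs t = Some 0 then None
      else binop (/) (operand_val A b rs s) (operand_val A b rs t))"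
| "op_val A b rs (Sqrt s) =
     Option.bind (operand_val A b rs s) (\<lambda>x. if x < 0 then None else Some (sqrt x))"

fun exec :: "real mat \<Rightarrow> real vec \<Rightarrow> real list \<Rightarrow> arith_op list \<Rightarrow> real list option" where
  "exec A b rs [] = Some rs"
| "exec A b rs (c # cs) = Option.bind (op_val A b rs c) (\<lambda>r. exec A b (rs @ [r]) cs)"

definition computes :: "program \<Rightarrow> real mat \<Rightarrow> real vec \<Rightarrow> real vec \<Rightarrow> bool" where
  "computes P A b x \<longleftrightarrow>
     (\<exists>rs. exec A b [] (operations P) = Some rs \<and>
           map (operand_val A b rs) (outputs P) = map Some (list_of_vec x))"

end

theory Submission
  imports Defs
begin

text \<open>Eliminate the unknowns in descending order of their index, that is, first the blocks
  \<open>p, \<dots>, 1\<close> and then block 0. An unknown of a block \<open>I > 0\<close> is coupled only to unknowns of the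
  same residue modulo \<open>m\<close> in at most \<open>l\<close> preceding blocks and to its cyclic neighbours in block 0.
  Fill-in respects these couplings, and inside block 0 it stays within the pattern
  \<open>\<bar>i - j\<bar> \<le> 2 \<or> i \<le> 1 \<or> j \<le> 1\<close>. Hence each elimination step involves at most \<open>l + 5\<close> further
  unknowns and costs a number of operations that depends on \<open>l\<close> only; positive definiteness is
  inherited by the Schur complements, so that no pivot vanishes.\<close>

section \<open>Quantities computed by straight-line programs\<close>

type_synonym quantity = "real mat \<times> real vec \<times> real vec \<Rightarrow> real"

text \<open>An instance is a triple of a matrix, a right-hand side and a solution. Programs do not read
  the solution; it is included so that its entries are quantities like all others.\<close>

definition value_of :: "arith_op list \<Rightarrow> operand \<Rightarrow> real mat \<times> real vec \<times> real vec \<Rightarrow> real option" where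
  "value_of cs s = (\<lambda>(A, b, x). Option.bind (exec A b [] cs) (\<lambda>rs. operand_val A b rs s))"

text \<open>The operand \<open>s\<close> is chosen before the instance \<open>w\<close>: one program
  with fixed result numbers has to serve all of \<open>Om\<close>. The demand that execution never
  fails matters even when \<open>F\<close> is empty.\<close>

definition computable :: "(real mat \<times> real vec \<times> real vec) set \<Rightarrow> nat \<Rightarrow> quantity set \<Rightarrow> bool" where
  "computable Om k F \<longleftrightarrow> (\<exists>cs. length cs \<le> k \<and>
     (\<forall>(A, b, x)\<in>Om. exec A b [] cs \<noteq> None) \<and>
     (\<forall>f\<in>F. \<exists>s. \<forall>w\<in>Om. value_of cs s w = Some (f w)))"

text \<open>Quantifying over all \<open>H\<close> above \<open>F\<close>, and retaining
  \<open>H\<close> in the conclusion, keeps everything computed so far available. Costs of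
  successive derivations therefore simply add.\<close>

definition derivable ::
    "(real mat \<times> real vec \<times> real vec) set \<Rightarrow> quantity set \<Rightarrow> nat \<Rightarrow> quantity set \<Rightarrow> bool" where
  "derivable Om F c G \<longleftrightarrow>
     (\<forall>k H. F \<subseteq> H \<longrightarrow> computable Om k H \<longrightarrow> computable Om (k + c) (H \<union> G))"

lemma exec_append:
  "exec A b rs (cs @ ds) = Option.bind (exec A b rs cs) (\<lambda>rs'. exec A b rs' ds)"
  by (induction cs arbitrary: rs) (auto simp: Option.bind_assoc)

lemma operand_val_append:
  "operand_val A b rs s = Some v \<Longrightarrow> operand_val A b (rs @ rs') s = Some v"
  by (cases s) (auto simp: nth_append split: if_splits)

text \<open>Results are addressed by absolute position, so operands keep their values when the
  program grows. The second hypothesis excludes that the new operation makes the whole execution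
  fail.\<close>

lemma value_of_snoc:
  assumes "value_of cs s w = Some v"
    and "op_val (fst w) (fst (snd w)) (the (exec (fst w) (fst (snd w)) [] cs)) c = Some r"
  shows "value_of (cs @ [c]) s w = Some v"
  using assms operand_val_append
  by (auto simp: value_of_def exec_append bind_eq_Some_conv split: prod.splits)

lemma derivable_op:
  assumes "f \<in> F" "g \<in> F"
    and "\<And>A b x rs s t. (A, b, x) \<in> Om \<Longrightarrow> operand_val A b rs s = Some (f (A, b, x)) \<Longrightarrow>
           operand_val A b rs t = Some (g (A, b, x)) \<Longrightarrow> op_val A b rs (oper s t) = Some (h (A, b, x))"
  shows "derivable Om F 1 {h}"
  unfolding derivable_def
proof (intro allI impI)
  fix k H assume "F \<subseteq> H" "computable Om k H"
  then obtain cs where cs: "length cs \<le> k" "\<forall>(A, b, x)\<in>Om. exec A b [] cs \<noteq> None"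
    "\<forall>f\<in>H. \<exists>s. \<forall>w\<in>Om. value_of cs s w = Some (f w)"
    unfolding computable_def by blast
  obtain s t where s: "\<forall>w\<in>Om. value_of cs s w = Some (f w)"
    and t: "\<forall>w\<in>Om. value_of cs t w = Some (g w)"
    using bspec[OF cs(3), of f] bspec[OF cs(3), of g] assms(1,2) \<open>F \<subseteq> H\<close> by (meson subsetD)
  define n where "n = length cs"
  \<comment> \<open>The number of results is the same for every instance, so \<open>Result n\<close>
    addresses the new operation uniformly on \<open>Om\<close>.\<close>
  have len: "length rs' = length rs + length cs" if "exec A b rs cs = Some rs'" for A b rs rs' and cs :: "arith_op list"
    using that by (induction cs arbitrary: rs) (auto simp: bind_eq_Some_conv)
  have ex: "\<exists>rs. exec A b [] cs = Some rs \<and> length rs = n \<and> op_val A b rs (oper s t) = Some (h (A, b, x))"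
    if "(A, b, x) \<in> Om" for A b x
  proof -
    obtain rs where rs: "exec A b [] cs = Some rs" using cs(2) \<open>(A, b, x) \<in> Om\<close> by auto
    have "operand_val A b rs s = Some (f (A, b, x))" "operand_val A b rs t = Some (g (A, b, x))"
      using s t that rs by (auto simp: value_of_def)
    from assms(3)[OF that this] rs len[OF rs] show ?thesis by (auto simp: n_def)
  qed
  show "computable Om (k + 1) (H \<union> {h})"
    unfolding computable_def
  proof (intro exI[of _ "cs @ [oper s t]"] conjI ballI)
    show "length (cs @ [oper s t]) \<le> k + 1" using cs(1) by simp
    show "case w of (A, b, x) \<Rightarrow> exec A b [] (cs @ [oper s t]) \<noteq> None" if "w \<in> Om" for w
      using ex that by (force simp: exec_append)
    show "\<exists>s'. \<forall>w\<in>Om. value_of (cs @ [oper s t]) s' w = Some (q w)" if "q \<in> H \<union> {h}" for q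
    proof (cases "q = h")
      case True
      have "value_of (cs @ [oper s t]) (Result n) w = Some (h w)" if "w \<in> Om" for w
      proof (cases w)
        case (fields A b x)
        then show ?thesis using ex[of A b x] that by (auto simp: value_of_def exec_append nth_append)
      qed
      then show ?thesis by (intro exI[of _ "Result n"]) (simp add: True)
    next
      case False
      then have "q \<in> H" using that by simp
      from bspec[OF cs(3) this] obtain s' where s': "\<forall>w\<in>Om. value_of cs s' w = Some (q w)" ..
      have "value_of (cs @ [oper s t]) s' w = Some (q w)" if "w \<in> Om" for w
      proof (cases w)
        case (fields A b x)
        then show ?thesis
          using ex[of A b x] that s' value_of_snoc[of cs s' w "q w" "oper s t" "h w"] by auto
      qed
      then show ?thesis by (intro exI[of _ s']) simp
    qed
  qed
qed

section \<open>Rules for the cost of derived quantities\<close>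

lemma derivable_add: "f \<in> F \<Longrightarrow> g \<in> F \<Longrightarrow> derivable Om F 1 {\<lambda>w. f w + g w}"
  by (rule derivable_op[where f = f and g = g and oper = Add]) (auto simp: binop_def)

lemma derivable_diff: "f \<in> F \<Longrightarrow> g \<in> F \<Longrightarrow> derivable Om F 1 {\<lambda>w. f w - g w}"
  by (rule derivable_op[where f = f and g = g and oper = Sub]) (auto simp: binop_def)

lemma derivable_mult: "f \<in> F \<Longrightarrow> g \<in> F \<Longrightarrow> derivable Om F 1 {\<lambda>w. f w * g w}"
  by (rule derivable_op[where f = f and g = g and oper = Mul]) (auto simp: binop_def)

lemma derivable_divide:
  "f \<in> F \<Longrightarrow> g \<in> F \<Longrightarrow> (\<And>w. w \<in> Om \<Longrightarrow> g w \<noteq> 0) \<Longrightarrow> derivable Om F 1 {\<lambda>w. f w / g w}"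
  by (rule derivable_op[where f = f and g = g and oper = Div]) (auto simp: binop_def)

lemma derivable_zero: "derivable Om F 0 {\<lambda>w. 0}"
  unfolding derivable_def computable_def
proof (clarify)
  fix H :: "quantity set" and cs :: "arith_op list" and k
  assume cs: "length cs \<le> k" "\<forall>(A, b, x)\<in>Om. exec A b [] cs \<noteq> None"
    "\<forall>f\<in>H. \<exists>s. \<forall>w\<in>Om. value_of cs s w = Some (f w)"
  have "\<forall>w\<in>Om. value_of cs (IntConst 0) w = Some 0"
    using cs(2) by (auto simp: value_of_def)
  with cs show "\<exists>cs. length cs \<le> k + 0 \<and> (\<forall>(A, b, x)\<in>Om. exec A b [] cs \<noteq> None) \<and>
     (\<forall>f\<in>H \<union> {\<lambda>w. 0}. \<exists>s. \<forall>w\<in>Om. value_of cs s w = Some (f w))"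
    by (intro exI[of _ cs]) auto
qed

text \<open>Quantities that agree on \<open>Om\<close> can share an operand. This makes trivial
  updates free and identifies a computed expression with an entry of the solution.\<close>

lemma derivable_cong:
  assumes "\<And>g. g \<in> G \<Longrightarrow> \<exists>f\<in>F. \<forall>w\<in>Om. f w = g w"
  shows "derivable Om F 0 G"
  unfolding derivable_def computable_def
proof (clarify)
  fix H :: "quantity set" and cs :: "arith_op list" and k
  assume H: "F \<subseteq> H"
    and cs: "length cs \<le> k" "\<forall>(A, b, x)\<in>Om. exec A b [] cs \<noteq> None"
    "\<forall>f\<in>H. \<exists>s. \<forall>w\<in>Om. value_of cs s w = Some (f w)"
  have "\<exists>s. \<forall>w\<in>Om. value_of cs s w = Some (g w)" if g: "g \<in> G" for g
  proof -
    obtain f where f: "f \<in> F" "\<forall>w\<in>Om. f w = g w" using assms[OF g] by (rule bexE)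
    from bspec[OF cs(3) subsetD[OF H f(1)]]
    obtain s where "\<forall>w\<in>Om. value_of cs s w = Some (f w)" ..
    then show ?thesis using f(2) by (intro exI[of _ s]) simp
  qed
  with cs show "\<exists>cs. length cs \<le> k + 0 \<and> (\<forall>(A, b, x)\<in>Om. exec A b [] cs \<noteq> None) \<and>
     (\<forall>f\<in>H \<union> G. \<exists>s. \<forall>w\<in>Om. value_of cs s w = Some (f w))"
    by (intro exI[of _ cs]) auto
qed

text \<open>Serves to forget intermediate results and to round costs up; members of
  \<open>F'\<close> may be listed among the results since they are already available.\<close>

lemma derivable_mono:
  assumes "derivable Om F c G" "F \<subseteq> F'" "c \<le> c'" "G' \<subseteq> F' \<union> G"
  shows "derivable Om F' c' G'"
  unfolding derivable_def
proof (intro allI impI)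
  fix k H assume H: "F' \<subseteq> H" "computable Om k H"
  then have "computable Om (k + c) (H \<union> G)"
    using assms(1,2) unfolding derivable_def by blast
  then obtain cs where cs: "length cs \<le> k + c" "\<forall>(A, b, x)\<in>Om. exec A b [] cs \<noteq> None"
    "\<forall>f\<in>H \<union> G. \<exists>s. \<forall>w\<in>Om. value_of cs s w = Some (f w)"
    unfolding computable_def by blast
  have sub: "H \<union> G' \<subseteq> H \<union> G" using assms H by auto
  show "computable Om (k + c') (H \<union> G')"
    unfolding computable_def
  proof (intro exI[of _ cs] conjI)
    show "length cs \<le> k + c'" using cs(1) assms(3) by simp
    show "\<forall>f\<in>H \<union> G'. \<exists>s. \<forall>w\<in>Om. value_of cs s w = Some (f w)"
      by (rule ballI, rule bspec[OF cs(3)], rule subsetD[OF sub])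
  qed (rule cs(2))
qed

lemma derivable_trans:
  assumes "derivable Om F c G" "derivable Om (F \<union> G) d H"
  shows "derivable Om F (c + d) (G \<union> H)"
  unfolding derivable_def
proof (intro allI impI)
  fix k K assume K: "F \<subseteq> K" "computable Om k K"
  then have "computable Om (k + c) (K \<union> G)"
    using assms(1) unfolding derivable_def by blast
  moreover have "F \<union> G \<subseteq> K \<union> G" using K(1) by auto
  ultimately have "computable Om (k + c + d) (K \<union> G \<union> H)"
    using assms(2) unfolding derivable_def by blast
  then show "computable Om (k + (c + d)) (K \<union> (G \<union> H))"
    by (simp only: add.assoc Un_assoc)
qed

lemma derivable_UN:
  assumes "finite S" "\<And>s. s \<in> S \<Longrightarrow> derivable Om F c (G s)"
  shows "derivable Om F (card S * c) (\<Union>s\<in>S. G s)"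
  using assms
proof (induction S rule: finite_induct)
  case empty
  then show ?case by (auto intro: derivable_cong)
next
  case (insert s S)
  have "derivable Om F (c + card S * c) (G s \<union> (\<Union>s\<in>S. G s))"
  proof (rule derivable_trans)
    show "derivable Om F c (G s)" using insert.prems by simp
    have "derivable Om F (card S * c) (\<Union>s\<in>S. G s)" using insert.prems by (intro insert.IH) auto
    then show "derivable Om (F \<union> G s) (card S * c) (\<Union>s\<in>S. G s)" by (rule derivable_mono) auto
  qed
  then show ?case using insert by simp
qed

text \<open>The summation starts from the constant 0, so every term, including the first, costs one
  addition.\<close>

lemma derivable_sum:
  assumes "finite S" "\<And>s. s \<in> S \<Longrightarrow> f s \<in> F"
  shows "derivable Om F (card S) {\<lambda>w. \<Sum>s\<in>S. f s w}"
  using assms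
proof (induction S rule: finite_induct)
  case empty
  then show ?case using derivable_zero by simp
next
  case (insert s S)
  let ?g = "\<lambda>w. \<Sum>s\<in>S. f s w"
  have "derivable Om F (card S + 1) ({?g} \<union> {\<lambda>w. f s w + ?g w})"
    using insert.prems by (intro derivable_trans derivable_add insert.IH) auto
  then show ?case
    by (rule derivable_mono) (use insert.hyps in auto)
qed

section \<open>Sparse Gaussian elimination\<close>

lemma sum_split_last_quadratic:
  fixes a :: "nat \<Rightarrow> nat \<Rightarrow> real"
  assumes "\<And>i. i < n \<Longrightarrow> a i n = a n i"
  shows "(\<Sum>i<Suc n. \<Sum>j<Suc n. a i j * z i * z j) =
    (\<Sum>i<n. \<Sum>j<n. a i j * z i * z j) + 2 * z n * (\<Sum>j<n. a n j * z j) + a n n * (z n)\<^sup>2"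
proof -
  have col: "(\<Sum>i<n. a i n * z i * z n) = z n * (\<Sum>j<n. a n j * z j)"
    using assms by (auto simp: sum_distrib_left intro!: sum.cong)
  have row: "(\<Sum>j<n. a n j * z n * z j) = z n * (\<Sum>j<n. a n j * z j)"
    by (auto simp: sum_distrib_left intro!: sum.cong)
  have "(\<Sum>i<Suc n. \<Sum>j<Suc n. a i j * z i * z j) =
      (\<Sum>i<n. \<Sum>j<n. a i j * z i * z j) + (\<Sum>i<n. a i n * z i * z n) +
      ((\<Sum>j<n. a n j * z n * z j) + a n n * z n * z n)"
    by (simp add: sum.distrib)
  then show ?thesis
    unfolding col row power2_eq_square by linarith
qed

text \<open>Symmetric positive definiteness for functions on indices: lowering \<open>n\<close>
  discards the last unknown without any change of matrix dimension, which suits the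
  induction.\<close>

definition pos_form :: "nat \<Rightarrow> (nat \<Rightarrow> nat \<Rightarrow> real) \<Rightarrow> bool" where
  "pos_form n a \<longleftrightarrow> (\<forall>i<n. \<forall>j<n. a i j = a j i) \<and>
     (\<forall>z. (\<exists>i<n. z i \<noteq> 0) \<longrightarrow> (\<Sum>i<n. \<Sum>j<n. a i j * z i * z j) > 0)"

text \<open>The pivot is the value of the form at the last unit vector.\<close>

lemma pos_form_diag:
  assumes "pos_form (Suc n) a"
  shows "a n n > 0"
proof -
  define z :: "nat \<Rightarrow> real" where "z i = (if i = n then 1 else 0)" for i
  have z: "z n = 1" "\<And>i. i < n \<Longrightarrow> z i = 0" by (auto simp: z_def)
  then have "\<exists>i<Suc n. z i \<noteq> 0" by (intro exI[of _ n]) simp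
  then have "(\<Sum>i<Suc n. \<Sum>j<Suc n. a i j * z i * z j) > 0"
    using assms unfolding pos_form_def by blast
  then show ?thesis by (simp add: z)
qed

text \<open>The form of the Schur complement at \<open>z\<close> is the minimum of the original form over the
  choice of the last coordinate.\<close>

lemma pos_form_schur:
  assumes pos: "pos_form (Suc n) a"
  shows "pos_form n (\<lambda>i j. a i j - a i n * a n j / a n n)"
  unfolding pos_form_def
proof (intro conjI allI impI)
  have sym: "a i j = a j i" if "i \<le> n" "j \<le> n" for i j
    using pos that unfolding pos_form_def by simp
  then show "a i j - a i n * a n j / a n n = a j i - a j n * a n i / a n n"
    if "i < n" "j < n" for i j
    using that by simp
  fix z :: "nat \<Rightarrow> real"
  assume nz: "\<exists>i<n. z i \<noteq> 0"
  define s where "s = (\<Sum>j<n. a n j * z j)"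
  \<comment> \<open>\<open>- s / a n n\<close> minimises the quadratic polynomial in the last
    coordinate; completing the square leaves \<open>- s * s / a n n\<close>.\<close>
  define z' where "z' = z(n := - s / a n n)"
  have ann: "a n n > 0" by (rule pos_form_diag[OF pos])
  obtain i where "i < n" "z i \<noteq> 0" using nz by blast
  then have "\<exists>i<Suc n. z' i \<noteq> 0" by (intro exI[of _ i]) (simp add: z'_def)
  then have "0 < (\<Sum>i<Suc n. \<Sum>j<Suc n. a i j * z' i * z' j)"
    using pos unfolding pos_form_def by blast
  also have "\<dots> = (\<Sum>i<n. \<Sum>j<n. a i j * z i * z j) + 2 * z' n * s + a n n * (z' n)\<^sup>2"
    using sum_split_last_quadratic[of n a z'] sym by (simp add: z'_def s_def)
  also have "\<dots> = (\<Sum>i<n. \<Sum>j<n. a i j * z i * z j) - s * s / a n n"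
    using ann by (simp add: z'_def field_simps power2_eq_square)
  also have "s * s = (\<Sum>i<n. \<Sum>j<n. a i n * a n j * z i * z j)"
    using sym unfolding s_def sum_product by (intro sum.cong) auto
  also have "(\<Sum>i<n. \<Sum>j<n. a i j * z i * z j) - (\<Sum>i<n. \<Sum>j<n. a i n * a n j * z i * z j) / a n n
      = (\<Sum>i<n. \<Sum>j<n. (a i j - a i n * a n j / a n n) * z i * z j)"
    by (simp add: left_diff_distrib sum_subtractf sum_divide_distrib)
  finally show "0 < (\<Sum>i<n. \<Sum>j<n. (a i j - a i n * a n j / a n n) * z i * z j)" .
qed

text \<open>Induction on \<open>n\<close>, eliminating the last unknown first. By
  \<open>fill\<close> the smaller neighbours of each unknown form a clique, so the descending order
  is a perfect elimination order of the graph \<open>E\<close>. Per unknown, at most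
  \<open>d * d\<close> coefficients and \<open>d\<close> right-hand sides are updated at 3
  operations each, and back substitution takes at most \<open>2 * d + 2\<close>.\<close>

lemma derivable_elimination:
  fixes E :: "nat \<Rightarrow> nat \<Rightarrow> bool" and a :: "nat \<Rightarrow> nat \<Rightarrow> quantity" and x y :: "nat \<Rightarrow> quantity"
  assumes refl: "\<And>v. v < n \<Longrightarrow> E v v"
    and sym: "\<And>v w. E v w \<Longrightarrow> E w v"
    and deg: "\<And>v. v < n \<Longrightarrow> card {w. w < v \<and> E v w} \<le> d"
    and fill: "\<And>v w w'. v < n \<Longrightarrow> w < v \<Longrightarrow> w' < v \<Longrightarrow> E v w \<Longrightarrow> E v w' \<Longrightarrow> E w w'"
    and pos: "\<And>\<omega>. \<omega> \<in> Om \<Longrightarrow> pos_form n (\<lambda>i j. a i j \<omega>)"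
    and zero: "\<And>\<omega> i j. \<omega> \<in> Om \<Longrightarrow> i < n \<Longrightarrow> j < n \<Longrightarrow> \<not> E i j \<Longrightarrow> a i j \<omega> = 0"
    and sol: "\<And>\<omega> i. \<omega> \<in> Om \<Longrightarrow> i < n \<Longrightarrow> (\<Sum>j<n. a i j \<omega> * x j \<omega>) = y i \<omega>"
    and entries: "\<And>i j. i < n \<Longrightarrow> j < n \<Longrightarrow> E i j \<Longrightarrow> a i j \<in> F"
    and rhs: "\<And>i. i < n \<Longrightarrow> y i \<in> F"
  shows "derivable Om F (n * (3 * d * d + 5 * d + 2)) (x ` {..<n})"
  using assms
proof (induction n arbitrary: a y F)
  case 0
  then show ?case by (auto intro: derivable_cong)
next
  case (Suc n)
  let ?c = "3 * d * d + 5 * d + 2"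
  \<comment> \<open>The unknowns coupled to the pivot that are still to be eliminated; only their
    equations change.\<close>
  define N where "N = {w. w < n \<and> E n w}"
  have [simp]: "finite N" by (simp add: N_def)
  have cN: "card N \<le> d" using Suc.prems(3)[of n] by (simp add: N_def)
  have piv: "a n n \<omega> \<noteq> 0" if "\<omega> \<in> Om" for \<omega>
    using pos_form_diag[OF Suc.prems(5)[OF that]] by simp
  have row_zero: "a n j \<omega> = 0" if "\<omega> \<in> Om" "j < n" "j \<notin> N" for j \<omega>
    using Suc.prems(6)[OF that(1), of n j] that by (auto simp: N_def)
  have asym: "a i n \<omega> = a n i \<omega>" if "\<omega> \<in> Om" "i < n" for i \<omega>
    using Suc.prems(5)[OF that(1)] that(2) unfolding pos_form_def by simp
  define a' where "a' i j = (\<lambda>\<omega>. a i j \<omega> - a i n \<omega> * a n j \<omega> / a n n \<omega>)" for i j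
  define y' where "y' i = (\<lambda>\<omega>. y i \<omega> - a i n \<omega> * y n \<omega> / a n n \<omega>)" for i
  have inF: "a i n \<in> F" "a n i \<in> F" if "i \<in> N" for i
    using that Suc.prems(8) Suc.prems(2) by (auto simp: N_def)
  have annF: "a n n \<in> F" using Suc.prems(1,8) by simp
  have update: "derivable Om F 3 {\<lambda>\<omega>. f \<omega> - g \<omega> * h \<omega> / a n n \<omega>}"
    if "f \<in> F" "g \<in> F" "h \<in> F" for f g h
  proof -
    let ?q = "\<lambda>\<omega>. g \<omega> * h \<omega>" and ?r = "\<lambda>\<omega>. g \<omega> * h \<omega> / a n n \<omega>"
    have "derivable Om F (1 + (1 + 1)) ({?q} \<union> ({?r} \<union> {\<lambda>\<omega>. f \<omega> - ?r \<omega>}))"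
      using that annF piv
      by (intro derivable_trans derivable_mult derivable_divide derivable_diff) auto
    then show ?thesis by (rule derivable_mono) auto
  qed
  let ?G1 = "\<Union>(i, j)\<in>N \<times> N. {a' i j}" and ?G2 = "\<Union>i\<in>N. {y' i}"
  have D1: "derivable Om F (card (N \<times> N) * 3) ?G1"
  proof (rule derivable_UN)
    show "derivable Om F 3 (case s of (i, j) \<Rightarrow> {a' i j})" if s: "s \<in> N \<times> N" for s
    proof (cases s)
      case (Pair i j)
      have "E i j" using Suc.prems(4)[of n i j] s Pair by (simp add: N_def)
      then have "a i j \<in> F" using s Pair Suc.prems(8) by (simp add: N_def)
      then show ?thesis using update[of "a i j" "a i n" "a n j"] inF s Pair by (simp add: a'_def)
    qed
  qed simp
  have D2: "derivable Om F (card N * 3) ?G2"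
  proof (rule derivable_UN)
    show "derivable Om F 3 {y' i}" if "i \<in> N" for i
      using update[of "y i" "a i n" "y n"] inF that Suc.prems(9) by (simp add: y'_def N_def)
  qed simp
  let ?F1 = "F \<union> ?G1 \<union> ?G2"
  let ?G3 = "{a' i j |i j. i < n \<and> j < n \<and> E i j} \<union> y' ` {..<n}"
  \<comment> \<open>Unless both indices lie in \<open>N\<close>, the correction vanishes on
    \<open>Om\<close> and the old coefficient serves as the new one; likewise for right-hand sides
    outside \<open>N\<close>.\<close>
  have D3: "derivable Om ?F1 0 ?G3"
  proof (rule derivable_cong)
    fix g assume "g \<in> ?G3"
    then consider i j where "g = a' i j" "i < n" "j < n" "E i j" | i where "g = y' i" "i < n" by auto
    then show "\<exists>f\<in>?F1. \<forall>\<omega>\<in>Om. f \<omega> = g \<omega>"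
    proof cases
      case 1
      show ?thesis
      proof (cases "i \<in> N \<and> j \<in> N")
        case True
        then show ?thesis using 1 by (intro bexI[of _ g]) auto
      next
        case False
        then have "a i j \<omega> = g \<omega>" if "\<omega> \<in> Om" for \<omega>
          using 1 that row_zero[OF that] asym[OF that] by (auto simp: a'_def)
        then show ?thesis using Suc.prems(8)[of i j] 1 by (intro bexI[of _ "a i j"]) auto
      qed
    next
      case 2
      show ?thesis
      proof (cases "i \<in> N")
        case True
        then show ?thesis using 2 by (intro bexI[of _ g]) auto
      next
        case False
        then have "y i \<omega> = g \<omega>" if "\<omega> \<in> Om" for \<omega>
          using 2 that row_zero[OF that] asym[OF that] by (auto simp: y'_def)
        then show ?thesis using Suc.prems(9)[of i] 2 by (intro bexI[of _ "y i"]) auto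
      qed
    qed
  qed
  let ?F2 = "?F1 \<union> ?G3"
  have last_eq: "a n n \<omega> * x n \<omega> = y n \<omega> - (\<Sum>j<n. a n j \<omega> * x j \<omega>)" if "\<omega> \<in> Om" for \<omega>
    using Suc.prems(7)[OF that, of n] by simp
  \<comment> \<open>The same \<open>x\<close>, restricted to indices below \<open>n\<close>, solves
    the reduced system, so the induction hypothesis yields its entries.\<close>
  have D4: "derivable Om ?F2 (n * ?c) (x ` {..<n})"
  proof (rule Suc.IH[where a = a' and y = y'])
    show "pos_form n (\<lambda>i j. a' i j \<omega>)" if "\<omega> \<in> Om" for \<omega>
      using pos_form_schur[OF Suc.prems(5)[OF that]] by (simp add: a'_def)
    show "a' i j \<omega> = 0" if "\<omega> \<in> Om" "i < n" "j < n" "\<not> E i j" for \<omega> i j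
    proof -
      \<comment> \<open>Contraposition of \<open>fill\<close>: outside \<open>E\<close> the
        correction vanishes as well, so no new nonzero appears there.\<close>
      have "i \<notin> N \<or> j \<notin> N" using Suc.prems(4)[of n i j] that by (auto simp: N_def)
      then show ?thesis
        using Suc.prems(6)[of \<omega> i j] that row_zero[OF that(1)] asym[OF that(1)] by (auto simp: a'_def)
    qed
    show "(\<Sum>j<n. a' i j \<omega> * x j \<omega>) = y' i \<omega>" if "\<omega> \<in> Om" "i < n" for \<omega> i
    proof -
      have "(\<Sum>j<n. a' i j \<omega> * x j \<omega>)
          = (\<Sum>j<n. a i j \<omega> * x j \<omega>) - a i n \<omega> / a n n \<omega> * (\<Sum>j<n. a n j \<omega> * x j \<omega>)"
        by (simp add: a'_def left_diff_distrib sum_subtractf sum_distrib_left mult.assoc)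
      also have "(\<Sum>j<n. a i j \<omega> * x j \<omega>) = y i \<omega> - a i n \<omega> * x n \<omega>"
        using Suc.prems(7)[OF that(1), of i] that by simp
      also have "(\<Sum>j<n. a n j \<omega> * x j \<omega>) = y n \<omega> - a n n \<omega> * x n \<omega>"
        using last_eq[OF that(1)] by simp
      finally show ?thesis using piv[OF that(1)] by (simp add: y'_def field_simps)
    qed
    show "a' i j \<in> ?F2" if "i < n" "j < n" "E i j" for i j using that by blast
    show "y' i \<in> ?F2" if "i < n" for i using that by blast
    show "E v v" if "v < n" for v using Suc.prems(1) that by simp
    show "E w v" if "E v w" for v w using Suc.prems(2) that .
    show "card {w. w < v \<and> E v w} \<le> d" if "v < n" for v using Suc.prems(3) that by simp
    show "E w w'" if "v < n" "w < v" "w' < v" "E v w" "E v w'" for v w w'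
      using Suc.prems(4)[of v w w'] that by simp
  qed
  let ?F3 = "?F2 \<union> x ` {..<n}"
  let ?P = "\<Union>j\<in>N. {\<lambda>\<omega>. a n j \<omega> * x j \<omega>}"
  let ?s = "\<lambda>\<omega>. \<Sum>j\<in>N. a n j \<omega> * x j \<omega>"
  let ?t = "\<lambda>\<omega>. y n \<omega> - ?s \<omega>"
  let ?u = "\<lambda>\<omega>. ?t \<omega> / a n n \<omega>"
  \<comment> \<open>Back substitution: products, their sum, one subtraction, one division; the
    quotient is then recognised as \<open>x n\<close> for free.\<close>
  have "derivable Om ?F3 (card N * 1 + (card N + (1 + (1 + 0)))) (?P \<union> ({?s} \<union> ({?t} \<union> ({?u} \<union> {x n}))))"
  proof (intro derivable_trans derivable_UN derivable_mult)
    show "derivable Om (?F3 \<union> ?P) (card N) {?s}"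
      by (rule derivable_sum) auto
    show "derivable Om (?F3 \<union> ?P \<union> {?s}) 1 {?t}"
      using Suc.prems(9) by (intro derivable_diff) auto
    show "derivable Om (?F3 \<union> ?P \<union> {?s} \<union> {?t}) 1 {?u}"
      using annF piv by (intro derivable_divide) auto
    show "derivable Om (?F3 \<union> ?P \<union> {?s} \<union> {?t} \<union> {?u}) 0 {x n}"
    proof (rule derivable_cong)
      have "?u \<omega> = x n \<omega>" if "\<omega> \<in> Om" for \<omega>
      proof -
        have "?s \<omega> = (\<Sum>j<n. a n j \<omega> * x j \<omega>)"
          using row_zero[OF that] by (intro sum.mono_neutral_left) (auto simp: N_def)
        then show ?thesis using last_eq[OF that] piv[OF that] by (simp add: field_simps)
      qed
      then show "\<exists>f\<in>?F3 \<union> ?P \<union> {?s} \<union> {?t} \<union> {?u}. \<forall>\<omega>\<in>Om. f \<omega> = g \<omega>" if "g \<in> {x n}" for g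
        using that by (intro bexI[of _ ?u]) auto
    qed
  qed (use inF in \<open>auto simp: N_def\<close>)
  then have D5: "derivable Om ?F3 (2 * card N + 2) {x n}"
    by (rule derivable_mono) auto
  have "derivable Om (F \<union> ?G1) (card N * 3) ?G2" by (rule derivable_mono[OF D2]) auto
  note D = derivable_trans[OF D1 derivable_trans[OF this derivable_trans[OF D3 derivable_trans[OF D4 D5]]]]
  have "card N * card N \<le> d * d" using cN by (intro mult_mono) auto
  then show ?case
    using cN by (intro derivable_mono[OF D]) (auto simp: card_cartesian_product lessThan_Suc)
qed

section \<open>The elimination pattern of arrowhead matrices\<close>

text \<open>The border pattern is cyclic tridiagonal and so covers both \<open>(1, 0)\<close> and
  \<open>(0, 1)\<close>. Eliminating an unknown of a block \<open>I > 0\<close> joins indices of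
  block 0 at cyclic distance at most 2. Pairs joined across the wrap have a member with index at
  most 1, and descending elimination inside block 0 spreads them only along rows and columns 0 and
  1.\<close>

definition arrow_pattern :: "nat \<Rightarrow> nat \<Rightarrow> nat \<Rightarrow> nat \<Rightarrow> bool" where
  "arrow_pattern m l v w \<longleftrightarrow>
     (let I = v div m; i = v mod m; J = w div m; j = w mod m in
      if I = 0 \<and> J = 0 then i \<le> j + 2 \<and> j \<le> i + 2 \<or> i \<le> 1 \<or> j \<le> 1
      else if I = 0 \<or> J = 0 then i \<le> j + 1 \<and> j \<le> i + 1 \<or> m + j \<le> i + 1 \<or> m + i \<le> j + 1
      else i = j \<and> I \<le> J + l \<and> J \<le> I + l)"

lemma arrow_pattern_refl: "arrow_pattern m l v v"
  by (simp add: arrow_pattern_def)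

lemma arrow_pattern_sym: "arrow_pattern m l v w \<Longrightarrow> arrow_pattern m l w v"
  by (auto simp: arrow_pattern_def Let_def split: if_splits)

text \<open>Inside block 0, the smaller neighbours of \<open>v\<close> are among
  \<open>v - 1\<close>, \<open>v - 2\<close>, 0 and 1, which are pairwise coupled. For
  \<open>v\<close> in a later block, two neighbours in block 0 have cyclic distance at most 2, and
  the others share the residue of \<open>v\<close>.\<close>

lemma arrow_pattern_fill:
  assumes "m > 0" "w < v" "w' < v" "arrow_pattern m l v w" "arrow_pattern m l v w'"
  shows "arrow_pattern m l w w'"
proof (cases "v div m = 0")
  case True
  then have "v < m" using assms(1) by (simp add: div_eq_0_iff)
  then show ?thesis using assms by (auto simp: arrow_pattern_def)
next
  case False
  define i j j' where "i = v mod m" and "j = w mod m" and "j' = w' mod m"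
  have "i < m" "j < m" "j' < m" using assms(1) by (auto simp: i_def j_def j'_def)
  \<comment> \<open>Neighbours in blocks of positive number thus lie at most \<open>l\<close> blocks
    before \<open>v\<close>, on the same side, hence within \<open>l\<close> blocks of each
    other.\<close>
  moreover have "w div m \<le> v div m" "w' div m \<le> v div m"
    using assms by (auto intro: div_le_mono)
  ultimately show ?thesis
    using assms(4,5) False
    unfolding arrow_pattern_def Let_def i_def[symmetric] j_def[symmetric] j'_def[symmetric]
    by (auto split: if_splits)
qed

text \<open>A later block contributes at most \<open>l\<close> smaller neighbours with the same
  residue and at most 5 candidates in block 0; inside block 0 there are at most 4.\<close>

lemma arrow_pattern_degree:
  assumes "m > 0"
  shows "card {w. w < v \<and> arrow_pattern m l v w} \<le> l + 5"
proof -
  define I i where "I = v div m" and "i = v mod m"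
  have im: "i < m" using assms by (simp add: i_def)
  let ?S = "{w. w < v \<and> arrow_pattern m l v w}"
  show ?thesis
  proof (cases "I = 0")
    case True
    then have "v < m" using assms by (simp add: I_def div_eq_0_iff)
    then have "?S \<subseteq> {0, 1, v - 1, v - 2}" by (auto simp: arrow_pattern_def)
    then have "card ?S \<le> card {0, 1, v - 1, v - 2}" by (intro card_mono) auto
    also have "\<dots> \<le> 4" by (simp add: card_insert_if)
    finally show ?thesis by simp
  next
    case False
    \<comment> \<open>\<open>?T\<close> covers the preceding blocks; \<open>?U\<close> covers the
      cyclic neighbours in block 0, with 0 and \<open>m - 1\<close> for the wrap. Truncated
      subtraction only adds harmless members to this superset.\<close>
    let ?T = "(\<lambda>k. (I - k) * m + i) ` {1..l}" and ?U = "{0, m - 1, i - 1, i, i + 1}"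
    have "?S \<subseteq> ?T \<union> ?U"
    proof
      fix w assume "w \<in> ?S"
      then have w: "w < v" "arrow_pattern m l v w" by auto
      define J j where "J = w div m" and "j = w mod m"
      have weq: "w = J * m + j" "j < m" using assms by (auto simp: J_def j_def)
      have veq: "v = I * m + i" by (simp add: I_def i_def)
      show "w \<in> ?T \<union> ?U"
      proof (cases "J = 0")
        case True
        then have "i \<le> j + 1 \<and> j \<le> i + 1 \<or> m + j \<le> i + 1 \<or> m + i \<le> j + 1"
          using w(2) False by (simp add: arrow_pattern_def Let_def I_def J_def i_def j_def)
        then have "j = 0 \<or> j = m - 1 \<or> j = i - 1 \<or> j = i \<or> j = i + 1" using weq(2) im by linarith
        then show ?thesis using weq True by auto
      next
        case J: False
        then have ij: "i = j" "I \<le> J + l"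
          using w(2) False by (auto simp: arrow_pattern_def Let_def I_def J_def i_def j_def)
        \<comment> \<open>With equal residues, the order of the indices is the order of the
          blocks.\<close>
        then have "J < I" using w(1) weq(1) veq by simp
        then have "w = (I - (I - J)) * m + i" "I - J \<in> {1..l}" using ij weq by auto
        then show ?thesis by blast
      qed
    qed
    then have "card ?S \<le> card (?T \<union> ?U)" by (intro card_mono) auto
    also have "\<dots> \<le> card ?T + card ?U" by (rule card_Un_le)
    also have "\<dots> \<le> l + 5"
      using card_image_le[of "{1..l}" "\<lambda>k. (I - k) * m + i"] by (intro add_mono) (auto simp: card_insert_if)
    finally show ?thesis .
  qed
qed

text \<open>As \<open>lam\<close> and \<open>mu\<close> are 0 and 1 in some order, the corner and
  all border blocks are at most cyclic tridiagonal.\<close>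

lemma CB3_zero_outside_pattern:
  assumes cb: "CB3 m p l l lam mu A" and lm: "(lam, mu) \<in> {(1, 0), (0, 1)}"
    and v: "v < m + p * m" and w: "w < m + p * m" and np: "\<not> arrow_pattern m l v w"
  shows "A $$ (v, w) = 0"
proof -
  define I i J j where "I = v div m" and "i = v mod m" and "J = w div m" and "j = w mod m"
  have m: "m > 0" using v by (cases m) auto
  have ij: "i < m" "j < m" using m by (auto simp: i_def j_def)
  have "v < Suc p * m" "w < Suc p * m" using v w by auto
  then have IJ: "I \<le> p" "J \<le> p"
    unfolding I_def J_def by (meson less_Suc_eq_le less_mult_imp_div_less)+
  have A: "A $$ (v, w) = mat_block m A I J $$ (i, j)"
    using ij by (simp add: mat_block_def I_def i_def J_def j_def)
  have band: "mat_block m A I J = 0\<^sub>m m m" if "\<not> (- int l \<le> int J - int I \<and> int J - int I \<le> int l)"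
    using cb IJ that unfolding CB3_def by blast
  \<comment> \<open>One statement for the corner and both borders, since all their sub-bandwidths
    are at most 1.\<close>
  have cyc: "B $$ (i, j) = 0" if "cyclic_banded m r s B" "r \<le> 1" "s \<le> 1"
    and "\<not> (i \<le> j + 1 \<and> j \<le> i + 1 \<or> m + j \<le> i + 1 \<or> m + i \<le> j + 1)" for B r s
  proof -
    have "(int i - int j > int r \<or> int j - int i > int s) \<and>
        \<not> (int m - int i + int j \<le> int s \<or> int m + int i - int j \<le> int r)"
      using that(2-4) by linarith
    then show ?thesis using that(1) ij unfolding cyclic_banded_def by blast
  qed
  consider "I = 0" "J = 0" | "I = 0" "J \<in> {1..p}" | "I \<in> {1..p}" "J = 0" | "I \<in> {1..p}" "J \<in> {1..p}"
    using IJ by fastforce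
  then have "mat_block m A I J $$ (i, j) = 0"
  proof cases
    case 1
    have "cyclic_banded m (lam + mu) (lam + mu) (mat_block m A I J)"
      using cb 1 unfolding CB3_def by simp
    \<comment> \<open>This excludes the cyclic tridiagonal positions too: wrapped entries lie in row
      or column 0.\<close>
    moreover have "\<not> (i \<le> j + 2 \<and> j \<le> i + 2 \<or> i \<le> 1 \<or> j \<le> 1)"
      using np 1 by (simp add: arrow_pattern_def Let_def I_def J_def i_def j_def)
    ultimately show ?thesis using lm ij by (intro cyc) auto
  next
    case 2
    then have "cyclic_banded m lam mu (mat_block m A I J)"
      using cb unfolding CB3_def by simp
    then show ?thesis using lm np 2
      by (intro cyc) (auto simp: arrow_pattern_def Let_def I_def J_def i_def j_def)
  next
    case 3
    then have "cyclic_banded m mu lam (mat_block m A I J)"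
      using cb unfolding CB3_def by simp
    then show ?thesis using lm np 3
      by (intro cyc) (auto simp: arrow_pattern_def Let_def I_def J_def i_def j_def)
  next
    case 4
    then have "\<not> (i = j \<and> I \<le> J + l \<and> J \<le> I + l)"
      using np by (simp add: arrow_pattern_def Let_def I_def J_def i_def j_def)
    then consider "i \<noteq> j" | "\<not> (- int l \<le> int J - int I \<and> int J - int I \<le> int l)" by linarith
    then show ?thesis
    proof cases
      case 1
      have "diagonal_mat (mat_block m A I J)" using cb 4 unfolding CB3_def by blast
      then show ?thesis using 1 ij by (simp add: diagonal_mat_def mat_block_def)
    next
      case 2
      then show ?thesis using band ij by simp
    qed
  qed
  then show ?thesis using A by simp
qed

section \<open>From matrices to the linear cost bound\<close>

lemma pos_form_if_sym_pos_def:
  assumes "sym_pos_def n A"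
  shows "pos_form n (\<lambda>i j. A $$ (i, j))"
  unfolding pos_form_def
proof (intro conjI allI impI)
  have A: "A \<in> carrier_mat n n" "transpose_mat A = A" using assms by (auto simp: sym_pos_def_def)
  show "A $$ (i, j) = A $$ (j, i)" if "i < n" "j < n" for i j
    using A that by (metis carrier_matD index_transpose_mat(1))
  fix z :: "nat \<Rightarrow> real" assume "\<exists>i<n. z i \<noteq> 0"
  then have "vec n z \<noteq> 0\<^sub>v n" by (metis index_vec index_zero_vec(1))
  then have "vec n z \<bullet> (A *\<^sub>v vec n z) > 0" using assms by (simp add: sym_pos_def_def)
  also have "vec n z \<bullet> (A *\<^sub>v vec n z) = (\<Sum>i<n. \<Sum>j<n. A $$ (i, j) * z i * z j)"
    using A by (auto simp: scalar_prod_def sum_distrib_left lessThan_atLeast0 intro!: sum.cong)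
  finally show "0 < (\<Sum>i<n. \<Sum>j<n. A $$ (i, j) * z i * z j)" .
qed

text \<open>\<open>C\<close> is fixed before \<open>m\<close> and \<open>p\<close>, and
  \<open>P\<close> before \<open>A\<close>, \<open>b\<close> and \<open>x\<close>: one program
  solves all systems of a given format. Positive definiteness makes \<open>x\<close> the unique
  solution.\<close>

theorem corollary1:
  fixes l :: nat
  shows "\<exists>C :: real. \<forall>m p :: nat. \<forall>(lam, mu) \<in> {(1, 0), (0, 1)}.
           \<exists>P :: program.
             real (num_ops P) \<le> C * real (m + p * m) \<and>
             (\<forall>(A :: real mat) (b :: real vec) (x :: real vec).
                A \<in> carrier_mat (m + p * m) (m + p * m) \<and>
                b \<in> carrier_vec (m + p * m) \<and> x \<in> carrier_vec (m + p * m) \<and>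
                sym_pos_def (m + p * m) A \<and> CB3 m p l l lam mu A \<and> A *\<^sub>v x = b
                \<longrightarrow> computes P A b x)"
proof -
  \<comment> \<open>\<open>d\<close> bounds the number of smaller neighbours in the pattern and
    \<open>c\<close> the cost per unknown; both depend on \<open>l\<close> only.\<close>
  define d where "d = l + 5"
  define c where "c = 3 * d * d + 5 * d + 2"
  have "\<exists>P. real (num_ops P) \<le> real c * real (m + p * m) \<and>
      (\<forall>A b x. A \<in> carrier_mat (m + p * m) (m + p * m) \<and>
          b \<in> carrier_vec (m + p * m) \<and> x \<in> carrier_vec (m + p * m) \<and>
          sym_pos_def (m + p * m) A \<and> CB3 m p l l lam mu A \<and> A *\<^sub>v x = b
          \<longrightarrow> computes P A b x)"
    if lm: "(lam, mu) \<in> {(1, 0), (0, 1)}" for m p lam mu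
  proof -
    define n where "n = m + p * m"
    define Om where "Om = {(A, b, x). A \<in> carrier_mat n n \<and> b \<in> carrier_vec n \<and>
      x \<in> carrier_vec n \<and> sym_pos_def n A \<and> CB3 m p l l lam mu A \<and> A *\<^sub>v x = b}"
    define a :: "nat \<Rightarrow> nat \<Rightarrow> quantity" where "a i j = (\<lambda>(A, b, x). A $$ (i, j))" for i j
    define y :: "nat \<Rightarrow> quantity" where "y i = (\<lambda>(A, b, x). b $ i)" for i
    define z :: "nat \<Rightarrow> quantity" where "z i = (\<lambda>(A, b, x). x $ i)" for i
    define F where "F = {a i j |i j. i < n \<and> j < n} \<union> y ` {..<n}"
    \<comment> \<open>For \<open>m = 0\<close> the dimension is 0 and there is no index, so the
      pattern lemmas apply wherever they are used.\<close>
    have m: "m > 0" if "v < n" for v using that by (cases m) (auto simp: n_def)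
    have "derivable Om F (n * (3 * d * d + 5 * d + 2)) (z ` {..<n})"
    proof (rule derivable_elimination[where E = "arrow_pattern m l" and a = a and y = y])
      show "arrow_pattern m l v v" for v by (rule arrow_pattern_refl)
      show "arrow_pattern m l w v" if "arrow_pattern m l v w" for v w
        using that by (rule arrow_pattern_sym)
      show "card {w. w < v \<and> arrow_pattern m l v w} \<le> d" if "v < n" for v
        using arrow_pattern_degree[OF m[OF that]] by (simp add: d_def)
      show "arrow_pattern m l w w'" if "v < n" "w < v" "w' < v" "arrow_pattern m l v w"
        "arrow_pattern m l v w'" for v w w'
        using arrow_pattern_fill[OF m[OF that(1)] that(2-5)] .
      show "pos_form n (\<lambda>i j. a i j \<omega>)" if "\<omega> \<in> Om" for \<omega>
        using that pos_form_if_sym_pos_def by (auto simp: Om_def a_def)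
      show "a i j \<omega> = 0" if "\<omega> \<in> Om" "i < n" "j < n" "\<not> arrow_pattern m l i j" for \<omega> i j
        using that CB3_zero_outside_pattern[OF _ lm] by (auto simp: Om_def a_def n_def)
      show "(\<Sum>j<n. a i j \<omega> * z j \<omega>) = y i \<omega>" if \<omega>: "\<omega> \<in> Om" and i: "i < n" for \<omega> i
      proof -
        obtain A b x where w: "\<omega> = (A, b, x)" by (cases \<omega>)
        then have "A \<in> carrier_mat n n" "x \<in> carrier_vec n" "b = A *\<^sub>v x" using \<omega> by (auto simp: Om_def)
        then show ?thesis using i
          by (auto simp: w a_def y_def z_def scalar_prod_def lessThan_atLeast0 intro!: sum.cong)
      qed
    qed (auto simp: F_def)
    \<comment> \<open>Input entries are read for free, so the empty program suffices.\<close>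
    moreover have "computable Om 0 F"
      unfolding computable_def
    proof (intro exI[of _ "[]"] conjI ballI)
      fix f assume "f \<in> F"
      then consider i j where "f = a i j" "i < n" "j < n" | i where "f = y i" "i < n"
        by (auto simp: F_def)
      then show "\<exists>s. \<forall>w\<in>Om. value_of [] s w = Some (f w)"
      proof cases
        case 1
        then show ?thesis
          by (intro exI[of _ "MatEntry i j"]) (auto simp: value_of_def Om_def a_def)
      next
        case 2
        then show ?thesis
          by (intro exI[of _ "RhsEntry i"]) (auto simp: value_of_def Om_def y_def)
      qed
    qed auto
    ultimately have "computable Om (0 + n * c) (F \<union> z ` {..<n})"
      unfolding derivable_def c_def by blast
    then obtain cs where cs: "length cs \<le> n * c"
      "\<forall>(A, b, x)\<in>Om. exec A b [] cs \<noteq> None"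
      "\<forall>f\<in>F \<union> z ` {..<n}. \<exists>s. \<forall>w\<in>Om. value_of cs s w = Some (f w)"
      unfolding computable_def by auto
    have "\<forall>i\<in>{..<n}. \<exists>s. \<forall>w\<in>Om. value_of cs s w = Some (z i w)" using cs(3) by blast
    \<comment> \<open>Choosing one operand per unknown, uniformly over \<open>Om\<close>, gives the
      output list.\<close>
    then obtain out where out: "\<forall>i\<in>{..<n}. \<forall>w\<in>Om. value_of cs (out i) w = Some (z i w)"
      using bchoice[of "{..<n}"] by metis
    define P where "P = Program cs (map out [0..<n])"
    have "computes P A b x" if w: "(A, b, x) \<in> Om" for A b x
    proof -
      obtain rs where rs: "exec A b [] cs = Some rs" using cs(2) w by auto
      have "operand_val A b rs (out i) = Some (x $ i)" if "i < n" for i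
        using out w that rs by (force simp: value_of_def z_def)
      moreover have "dim_vec x = n" using w by (auto simp: Om_def)
      ultimately show ?thesis
        unfolding computes_def P_def using rs by (auto simp: list_of_vec_map)
    qed
    moreover have "real (num_ops P) \<le> real c * real n"
      using cs(1) unfolding P_def num_ops_def by (simp add: mult.commute flip: of_nat_mult)
    ultimately show ?thesis
      unfolding Om_def n_def by (intro exI[of _ P]) auto
  qed
  then show ?thesis by (intro exI[of _ "real c"]) auto
qed

end
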